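(* Let $I\subseteq \mathbb{F}_q[X_1,\ldots,X_m]$ be an ideal, $\prec$ a monomial ordering, and $\Delta_\prec(I_q)=\{M_1,\ldots,M_n\}$ with $M_1\prec\cdots\prec M_n$. For each $i$ let $\sigma(M_i)$ be an integer such that for every polynomial $F$ with $\mathrm{Supp}(F)\subseteq\Delta_\prec(I_q)$ and $\mathrm{lm}(F)=M_i$, at least $\sigma(M_i)$ monomials of $\Delta_\prec(I_q)$ are leading monomials of polynomials in the ideal $\langle F\rangle+I_q$. (1) Let $L\subseteq\Delta_\prec(I_q)$ be nonempty. Then the minimum distance of $C(I,L)$ is at least $\min\{\sigma(M)\mid M\in L\}$. (2) Let $L_2\subsetneq L_1\subseteq\Delta_\prec(I_q)$ and define $n(L_1,L_2)=\min\{i\mid M_i\in L_1\setminus L_2\}$. Then the relative distance $d(C(I,L_1),C(I,L_2))$ is greater than or equal to $$\min\{\sigma(M_i)\mid M_i\in L_1,\ n(L_1,L_2)\le i\}.$$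
   Context: $\mathbb{F}_q$ is the finite field with $q$ elements. For an ideal $J$ of $\mathbb{F}_q[X_1,\ldots,X_m]$ the footprint $\Delta_\prec(J)$ is the set of monomials that are not the leading monomial (w.r.t. $\prec$) of any polynomial in $J$. For an ideal $I$ put $I_q=I+\langle X_1^q-X_1,\ldots,X_m^q-X_m\rangle$. The variety $\mathbb{V}(I_q)=\{P_1,\ldots,P_n\}\subseteq\mathbb{F}_q^m$ is finite, $n=\#\Delta_\prec(I_q)$, and $\mathrm{ev}(F)=(F(P_1),\ldots,F(P_n))\in\mathbb{F}_q^n$ for a polynomial $F$; this induces an isomorphism $\mathbb{F}_q[X_1,\ldots,X_m]/I_q\to\mathbb{F}_q^n$ of vector spaces. For $L\subseteq\Delta_\prec(I_q)$, $C(I,L)=\mathrm{Span}_{\mathbb{F}_q}\{\mathrm{ev}(M)\mid M\in L\}$. $\mathrm{lm}(F)$ is the leading monomial of $F$ w.r.t. $\prec$, and $\mathrm{Supp}(F)$ is the set of monomials with nonzero coefficient in $F$. For nested linear codes $C''\subsetneq C'$ the relative distance is $d(C',C'')=\min\{w_H(\vec c)\mid \vec c\in C'\setminus C''\}$, where $w_H$ denotes Hamming weight. *)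

theory Defs
  imports "HOL-Analysis.Cartesian_Space" "HOL-Library.Poly_Mapping"
begin

text \<open>
  Monomials in the variables indexed by \<open>'m\<close> are identified with their exponent vectors.
  A monomial ordering is given by its strict part.
\<close>

type_synonym 'm monom = "'m \<Rightarrow>\<^sub>0 nat"
type_synonym ('m, 'a) mpoly = "'m monom \<Rightarrow>\<^sub>0 'a"

definition monomial_ordering :: "('m monom \<Rightarrow> 'm monom \<Rightarrow> bool) \<Rightarrow> bool" where
  "monomial_ordering prec \<longleftrightarrow>
     transp prec \<and> irreflp prec \<and> totalp prec \<and> wfp prec \<and>
     (\<forall>s t u. prec s t \<longrightarrow> prec (s + u) (t + u))"

text \<open>Meaningful for \<open>F \<noteq> 0\<close> only; every use below carries that side condition.\<close>

definition lm :: "('m monom \<Rightarrow> 'm monom \<Rightarrow> bool) \<Rightarrow> ('m, 'a::zero) mpoly \<Rightarrow> 'm monom" where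
  "lm prec F = (THE t. t \<in> Poly_Mapping.keys F \<and> (\<forall>s\<in>Poly_Mapping.keys F. s \<noteq> t \<longrightarrow> prec s t))"

definition lead_monoms ::
    "('m monom \<Rightarrow> 'm monom \<Rightarrow> bool) \<Rightarrow> ('m, 'a::zero) mpoly set \<Rightarrow> 'm monom set" where
  "lead_monoms prec J = {lm prec F | F. F \<in> J \<and> F \<noteq> 0}"

definition footprint ::
    "('m monom \<Rightarrow> 'm monom \<Rightarrow> bool) \<Rightarrow> ('m, 'a::zero) mpoly set \<Rightarrow> 'm monom set" where
  "footprint prec J = - lead_monoms prec J"

text \<open>
  Ideals of a commutative ring are its submodules: \<open>ideal.subspace J\<close> says that \<open>J\<close> is an
  ideal, and \<open>ideal.span S\<close> is the ideal generated by \<open>S\<close>.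
\<close>

interpretation ideal: module "(*) :: 'a::comm_ring_1 \<Rightarrow> 'a \<Rightarrow> 'a"
  by unfold_locales (simp_all add: algebra_simps)

definition ideal_sum :: "'a::comm_ring_1 set \<Rightarrow> 'a set \<Rightarrow> 'a set" where
  "ideal_sum J K = {f + g | f g. f \<in> J \<and> g \<in> K}"

definition monom_poly :: "'m monom \<Rightarrow> ('m, 'a::comm_ring_1) mpoly" where
  "monom_poly t = Poly_Mapping.single t 1"

definition Var :: "'m \<Rightarrow> ('m, 'a::comm_ring_1) mpoly" where
  "Var x = monom_poly (Poly_Mapping.single x 1)"

text \<open>The coefficient field is the finite type \<open>'a\<close>, so \<open>q = CARD('a)\<close>.\<close>

definition Iq :: "('m, 'a::{field,finite}) mpoly set \<Rightarrow> ('m, 'a) mpoly set" where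
  "Iq I = ideal_sum I (ideal.span {Var x ^ CARD('a) - Var x | x. True})"

definition poly_eval :: "('m::finite, 'a::comm_ring_1) mpoly \<Rightarrow> 'a ^ 'm \<Rightarrow> 'a" where
  "poly_eval F p = (\<Sum>t\<in>Poly_Mapping.keys F. Poly_Mapping.lookup F t * (\<Prod>x\<in>UNIV. (p $ x) ^ Poly_Mapping.lookup t x))"

definition variety :: "('m::finite, 'a::comm_ring_1) mpoly set \<Rightarrow> ('a ^ 'm) set" where
  "variety J = {p. \<forall>F\<in>J. poly_eval F p = 0}"

text \<open>
  The coordinates of the ambient space of a code are indexed by a finite type \<open>'n\<close>;
  \<open>P\<close> is an enumeration of the points of the variety.
\<close>

definition ev :: "('n::finite \<Rightarrow> 'a ^ 'm) \<Rightarrow> ('m::finite, 'a::comm_ring_1) mpoly \<Rightarrow> 'a ^ 'n" where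
  "ev P F = (\<chi> j. poly_eval F (P j))"

definition code :: "('n::finite \<Rightarrow> 'a ^ 'm) \<Rightarrow> 'm::finite monom set \<Rightarrow> ('a::field ^ 'n) set" where
  "code P L = vec.span {ev P (monom_poly t) | t. t \<in> L}"

definition hamming_weight :: "'a::zero ^ 'n::finite \<Rightarrow> nat" where
  "hamming_weight c = card {j. c $ j \<noteq> 0}"

definition hamming_dist :: "'a ^ 'n::finite \<Rightarrow> 'a ^ 'n \<Rightarrow> nat" where
  "hamming_dist c d = card {j. c $ j \<noteq> d $ j}"

text \<open>
  Both minima range over sets of naturals bounded by \<open>CARD('n)\<close>; they are unspecified if
  the code has fewer than two words, respectively if \<open>C' - C''\<close> is empty.
\<close>

definition min_distance :: "('a ^ 'n::finite) set \<Rightarrow> nat" where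
  "min_distance C = Min {hamming_dist c d | c d. c \<in> C \<and> d \<in> C \<and> c \<noteq> d}"

definition relative_distance :: "('a::zero ^ 'n::finite) set \<Rightarrow> ('a ^ 'n) set \<Rightarrow> nat" where
  "relative_distance C' C'' = Min {hamming_weight c | c. c \<in> C' - C''}"

end

theory Submission
  imports Defs "HOL-Computational_Algebra.Polynomial"
begin

text \<open>
  A polynomial that vanishes on the variety of \<open>I_q\<close> lies in \<open>I_q\<close>: the products
  \<open>E_p = \<Prod>x. l_p(X_x)\<close> of univariate Lagrange polynomials satisfy \<open>G E_p \<equiv> G(p) E_p\<close> modulo
  the field equations, so \<open>G E_p\<close> is in \<open>I_q\<close> for every point \<open>p\<close>, and the \<open>E_p\<close> sum to \<open>1\<close>
  modulo the field equations.

  Given \<open>F\<close>, choose for every footprint monomial \<open>t\<close> that is a leading monomial in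
  \<open>\<langle>F\<rangle> + I_q\<close> such a polynomial \<open>G_t\<close>. A nontrivial combination of the \<open>G_t\<close> has its leading
  monomial in the footprint, so it is not in \<open>I_q\<close> and does not vanish on the variety. The
  vectors \<open>ev(G_t)\<close> are therefore linearly independent, and they are supported where \<open>ev(F)\<close>
  is nonzero; hence there are at most \<open>w_H(ev(F))\<close> of them. Both bounds follow, since a
  codeword is \<open>ev(F)\<close> with \<open>F\<close> supported on \<open>L\<close>, and since a word outside \<open>C(I, L_2)\<close> forces a
  monomial of \<open>L_1 - L_2\<close> into the support of \<open>F\<close>.
\<close>

section \<open>Univariate polynomials over a finite field\<close>

text \<open>For nonzero \<open>c\<close>, multiplication by \<open>c\<close> permutes the nonzero
  elements; comparing their product before and after gives \<open>c ^ (q - 1) = 1\<close>.\<close>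

lemma power_card_eq_same:
  fixes c :: "'a::{field,finite}"
  shows "c ^ CARD('a) = c"
proof (cases "c = 0")
  case True
  then show ?thesis by (simp add: power_0_left)
next
  case False
  let ?U = "UNIV - {0::'a}"
  have "bij_betw ((*) c) ?U ?U"
    by (rule bij_betwI[where g = "\<lambda>y. y / c"]) (use False in auto)
  then have "(\<Prod>y\<in>?U. c * y) = \<Prod>?U"
    by (rule prod.reindex_bij_betw)
  then have "c ^ card ?U * \<Prod>?U = 1 * \<Prod>?U"
    by (simp add: prod.distrib)
  then have "c ^ card ?U = 1"
    by (subst (asm) mult_cancel_right) simp
  moreover have "CARD('a) = Suc (card ?U)"
    by (simp add: card_Diff_singleton)
  ultimately show ?thesis by (simp only: power_Suc mult_1_right)
qed

text \<open>The remainder modulo \<open>X^q - X\<close> has degree below \<open>q\<close> but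
  vanishes at all \<open>q\<close> field elements, so it is zero.\<close>

lemma vanishing_poly_dvd:
  fixes f :: "'a::{field,finite} poly"
  assumes "\<And>c. poly f c = 0"
  shows "monom 1 CARD('a) - [:0, 1:] dvd f"
proof -
  \<comment> \<open>Since \<open>0\<close> and \<open>1\<close> differ, \<open>X^q\<close> really is
    the leading term of \<open>X^q - X\<close>.\<close>
  have q: "CARD('a) > 1"
    using card_mono[of UNIV "{0, 1::'a}"] by simp
  let ?g = "monom 1 CARD('a) - [:0, 1:] :: 'a poly"
  have deg: "degree ?g = CARD('a)"
    using q degree_add_eq_left[of "- [:0, 1:]" "monom 1 CARD('a) :: 'a poly"]
    by (simp add: degree_monom_eq flip: diff_conv_add_uminus del: minus_pCons)
  have "poly (f mod ?g) c = 0" for c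
  proof -
    have "poly (f mod ?g) c = poly (f - f div ?g * ?g) c"
      by (simp only: minus_div_mult_eq_mod)
    also have "\<dots> = 0"
      using assms by (simp add: poly_monom power_card_eq_same)
    finally show ?thesis .
  qed
  moreover have "degree (f mod ?g) < CARD('a)"
    using degree_mod_less[of ?g f] deg q by force
  ultimately have "f mod ?g = 0"
    using card_poly_roots_bound[of "f mod ?g"] by auto
  then show ?thesis by (simp add: dvd_eq_mod_eq_0)
qed

lemma ex_indicator_poly:
  fixes b :: "'a::{field,finite}"
  shows "\<exists>p. \<forall>c. poly p c = (if c = b then 1 else 0)"
proof -
  let ?h = "\<Prod>d\<in>UNIV - {b}. [:- d, 1:]"
  have 1: "poly ?h b \<noteq> 0" by (simp add: poly_prod)
  have 2: "poly ?h c = 0" if "c \<noteq> b" for c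
    using that by (simp add: poly_prod)
  have "poly (smult (inverse (poly ?h b)) ?h) c = (if c = b then 1 else 0)" for c
    using 1 2 by simp
  then show ?thesis by blast
qed

section \<open>Multivariate polynomials: constants, induction and evaluation\<close>

definition Const :: "'a \<Rightarrow> ('m, 'a::comm_ring_1) mpoly" where
  "Const c = Poly_Mapping.single 0 c"

lemma Const_0 [simp]: "Const 0 = 0"
  and Const_1 [simp]: "Const 1 = 1"
  and Const_add: "Const (a + b) = Const a + Const b"
  and Const_uminus: "Const (- a) = - Const a"
  and Const_mult: "Const (a * b) = Const a * Const b"
  by (simp_all add: Const_def single_add single_uminus mult_single)

lemma lookup_Const_mult: "Poly_Mapping.lookup (Const c * F) t = c * Poly_Mapping.lookup F t"
  unfolding Const_def mult_map_scale_conv_mult[symmetric]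
  by (simp add: Poly_Mapping.map.rep_eq when_def)

text \<open>Serves two levels: polynomials as sums of terms, and exponent vectors as sums of powers
  of single variables.\<close>

lemma poly_mapping_single_induct [case_names single add]:
  assumes single: "\<And>t c. Q (Poly_Mapping.single t c)"
    and add: "\<And>F G. Q F \<Longrightarrow> Q G \<Longrightarrow> Q (F + G)"
  shows "Q (F :: 'b \<Rightarrow>\<^sub>0 'c::monoid_add)"
proof (induction F rule: update_induct)
  case const
  \<comment> \<open>Zero is the single term with coefficient 0 at an arbitrary key.\<close>
  then show ?case using single[of undefined 0] by simp
next
  case (update F t c)
  have "Poly_Mapping.update t c F = F + Poly_Mapping.single t c"
    using update.hyps(1)
    by (intro poly_mapping_eqI) (auto simp: lookup_update lookup_add lookup_single when_def in_keys_iff)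
  then show ?case using update.IH single add by simp
qed

lemma monom_poly_add: "monom_poly (s + t) = monom_poly s * monom_poly t"
  by (simp add: monom_poly_def mult_single)

text \<open>Constants and variables generate the polynomial ring, so a property closed under sums
  and products need only be checked on them.\<close>

lemma mpoly_induct [case_names Const Var add mult]:
  fixes F :: "('m, 'a::comm_ring_1) mpoly"
  assumes Const: "\<And>c. Q (Const c)" and Var: "\<And>x. Q (Var x)"
    and add: "\<And>F G. Q F \<Longrightarrow> Q G \<Longrightarrow> Q (F + G)"
    and mult: "\<And>F G. Q F \<Longrightarrow> Q G \<Longrightarrow> Q (F * G)"
  shows "Q F"
proof (induction F rule: poly_mapping_single_induct)
  case (single t c)
  have "Q (monom_poly t)"
  proof (induction t rule: poly_mapping_single_induct)
    case (single x k)
    show ?case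
    proof (induction k)
      case 0
      then show ?case using Const[of 1] by (simp add: monom_poly_def)
    next
      case (Suc k)
      have "Poly_Mapping.single x (Suc k) = Poly_Mapping.single x 1 + Poly_Mapping.single x k"
        by (simp flip: single_add)
      then show ?case
        using mult[OF Var Suc.IH] by (simp add: monom_poly_add Var_def)
    qed
  next
    case (add s t)
    then show ?case by (simp add: monom_poly_add mult)
  qed
  moreover have "Poly_Mapping.single t c = Const c * monom_poly t"
    by (simp add: Const_def monom_poly_def mult_single)
  ultimately show ?case using mult Const by simp
next
  case (add F G)
  then show ?case by (rule assms)
qed

definition monom_eval :: "'a ^ 'm \<Rightarrow> 'm::finite monom \<Rightarrow> 'a::comm_ring_1" where
  "monom_eval p t = (\<Prod>x\<in>UNIV. (p $ x) ^ Poly_Mapping.lookup t x)"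

text \<open>Allows several polynomials to be evaluated over one common index set although their
  supports differ.\<close>

lemma poly_eval_eq_sum:
  assumes "finite T" "Poly_Mapping.keys F \<subseteq> T"
  shows "poly_eval F p = (\<Sum>t\<in>T. Poly_Mapping.lookup F t * monom_eval p t)"
  unfolding poly_eval_def monom_eval_def[symmetric]
  using assms by (intro sum.mono_neutral_left) (auto simp: in_keys_iff)

lemma poly_eval_single: "poly_eval (Poly_Mapping.single t c) p = c * monom_eval p t"
  by (subst poly_eval_eq_sum[of "{t}"]) auto

lemma poly_eval_add: "poly_eval (F + G) p = poly_eval F p + poly_eval G p"
proof -
  let ?T = "Poly_Mapping.keys F \<union> Poly_Mapping.keys G"
  show ?thesis
    using keys_add[of F G]
    by (simp add: poly_eval_eq_sum[of ?T] lookup_add algebra_simps sum.distrib)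
qed

lemma poly_eval_Const: "poly_eval (Const c) p = c"
  by (simp add: Const_def poly_eval_single monom_eval_def)

lemma poly_eval_Var: "poly_eval (Var x) p = p $ x"
proof -
  have "(\<Prod>y\<in>UNIV. (p $ y) ^ (1 when x = y)) = (\<Prod>y\<in>{x}. p $ y)"
    by (rule prod.mono_neutral_cong_right) auto
  then show ?thesis
    by (simp add: Var_def monom_poly_def poly_eval_single monom_eval_def lookup_single)
qed

lemma monom_eval_add: "monom_eval p (s + t) = monom_eval p s * monom_eval p t"
  by (simp add: monom_eval_def lookup_add power_add prod.distrib)

text \<open>Additivity in both factors reduces the claim to two single terms, whose exponents
  add.\<close>

lemma poly_eval_mult: "poly_eval (F * G) p = poly_eval F p * poly_eval G p"
proof (induction F rule: poly_mapping_single_induct)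
  case (single s c)
  show ?case
  proof (induction G rule: poly_mapping_single_induct)
    case (single t d)
    then show ?case by (simp add: mult_single poly_eval_single monom_eval_add)
  next
    case (add G1 G2)
    then show ?case by (simp add: poly_eval_add distrib_left)
  qed
next
  case (add F1 F2)
  then show ?case by (simp add: poly_eval_add distrib_right)
qed

lemma poly_eval_0 [simp]: "poly_eval 0 p = 0"
  by (simp add: poly_eval_def)

lemma poly_eval_minus: "poly_eval (F - G) p = poly_eval F p - poly_eval G p"
  by (simp add: eq_diff_eq flip: poly_eval_add)

lemma poly_eval_sum: "poly_eval (sum F A) p = (\<Sum>a\<in>A. poly_eval (F a) p)"
  by (induction A rule: infinite_finite_induct) (simp_all add: poly_eval_add)

section \<open>Substituting a variable into a univariate polynomial\<close>

text \<open>The ring homomorphism that embeds the univariate polynomials as the polynomials in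
  \<open>Var x\<close> alone; it carries univariate divisibility over to ideals.\<close>

definition subst_Var :: "'m \<Rightarrow> 'a::comm_ring_1 poly \<Rightarrow> ('m, 'a) mpoly" where
  "subst_Var x p = poly (map_poly Const p) (Var x)"

lemma subst_Var_0 [simp]: "subst_Var x 0 = 0"
  by (simp add: subst_Var_def)

lemma subst_Var_pCons [simp]: "subst_Var x (pCons a p) = Const a + Var x * subst_Var x p"
  by (simp add: subst_Var_def map_poly_pCons)

lemma subst_Var_add: "subst_Var x (p + r) = subst_Var x p + subst_Var x r"
  by (induction p r rule: poly_induct2) (simp_all add: Const_add algebra_simps)

lemma subst_Var_smult: "subst_Var x (smult c p) = Const c * subst_Var x p"
  by (induction p) (simp_all add: Const_mult distrib_left mult.left_commute)

lemma subst_Var_mult: "subst_Var x (p * r) = subst_Var x p * subst_Var x r"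
proof (induction p)
  case 0
  then show ?case by simp
next
  case (pCons a p)
  have "subst_Var x (pCons a p * r) = Const a * subst_Var x r + Var x * subst_Var x (p * r)"
    by (simp add: subst_Var_add subst_Var_smult)
  also have "\<dots> = subst_Var x (pCons a p) * subst_Var x r"
    by (simp only: pCons.IH subst_Var_pCons distrib_right mult.assoc)
  finally show ?case .
qed

lemma subst_Var_minus: "subst_Var x (p - r) = subst_Var x p - subst_Var x r"
  by (simp add: eq_diff_eq flip: subst_Var_add)

lemma subst_Var_sum: "subst_Var x (sum p A) = (\<Sum>a\<in>A. subst_Var x (p a))"
  by (induction A rule: infinite_finite_induct) (simp_all add: subst_Var_add)

lemma subst_Var_monom: "subst_Var x (monom c k) = Const c * Var x ^ k"
  by (induction k) (simp_all add: monom_0 monom_Suc mult.left_commute)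

lemma subst_Var_X_minus: "subst_Var x [:- c, 1:] = Var x - Const c"
  by (simp add: Const_uminus)

text \<open>A polynomial vanishing on the whole field is a multiple of \<open>X^q - X\<close>, and
  substitution turns this into a multiple of the field equation for \<open>x\<close>.\<close>

lemma subst_Var_vanishing:
  fixes f :: "'a::{field,finite} poly"
  assumes J: "ideal.subspace J" and field: "Var x ^ CARD('a) - Var x \<in> J"
    and f: "\<And>c. poly f c = 0"
  shows "subst_Var x f \<in> J"
proof -
  obtain h where "f = (monom 1 CARD('a) - [:0, 1:]) * h"
    using vanishing_poly_dvd[OF f] unfolding dvd_def by blast
  then have "subst_Var x f = subst_Var x h * (Var x ^ CARD('a) - Var x)"
    by (simp only: subst_Var_mult subst_Var_minus subst_Var_monom) (simp add: mult.commute)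
  then show ?thesis
    using ideal.subspace_scale[OF J field] by simp
qed

section \<open>Point indicators and the Nullstellensatz over a finite field\<close>

text \<open>A Lagrange polynomial. Any choice will do: two of them differ by a polynomial vanishing
  on the whole field.\<close>

definition point_indicator :: "'a::{field,finite} \<Rightarrow> 'a poly" where
  "point_indicator b = (SOME p. \<forall>c. poly p c = (if c = b then 1 else 0))"

lemma poly_point_indicator: "poly (point_indicator b) c = (if c = b then 1 else 0)"
  using someI_ex[OF ex_indicator_poly[of b]] unfolding point_indicator_def by blast

text \<open>Membership may be tested after multiplying by each product of indicators. The variables
  of \<open>S\<close> are removed one by one, because the indicators in one variable sum to 1 modulo
  its field equation.\<close>

lemma ideal_localize:
  fixes J :: "('m, 'a::{field,finite}) mpoly set"
  assumes J: "ideal.subspace J" and field: "\<And>x. Var x ^ CARD('a) - Var x \<in> J"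
    and "finite S"
    and "\<And>a :: 'm \<Rightarrow> 'a. H * (\<Prod>x\<in>S. subst_Var x (point_indicator (a x))) \<in> J"
  shows "H \<in> J"
  using assms(3,4)
proof (induction S)
  case empty
  then show ?case by simp
next
  case (insert y S)
  have "H * (\<Prod>x\<in>S. subst_Var x (point_indicator (a x))) \<in> J" for a :: "'m \<Rightarrow> 'a"
  proof -
    let ?E = "H * (\<Prod>x\<in>S. subst_Var x (point_indicator (a x)))"
    let ?f = "(\<Sum>b\<in>UNIV. point_indicator b) - 1 :: 'a poly"
    have "?E * subst_Var y (point_indicator b) \<in> J" for b
    proof -
      \<comment> \<open>As \<open>y\<close> is not in \<open>S\<close>, the value of
        \<open>a\<close> at \<open>y\<close> can be set to any \<open>b\<close> without changing the
        product over \<open>S\<close>.\<close>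
      have "(\<Prod>x\<in>S. subst_Var x (point_indicator ((a(y := b)) x)))
          = (\<Prod>x\<in>S. subst_Var x (point_indicator (a x)))"
        using insert.hyps by (intro prod.cong) auto
      then show ?thesis
        using insert.prems[of "a(y := b)"]
        by (simp only: prod.insert[OF insert.hyps] fun_upd_same mult_ac)
    qed
    then have sum_in: "(\<Sum>b\<in>UNIV. ?E * subst_Var y (point_indicator b)) \<in> J"
      by (intro ideal.subspace_sum[OF J])
    \<comment> \<open>At each \<open>c\<close> exactly one indicator takes the value 1.\<close>
    have "poly ?f c = 0" for c
      by (simp add: poly_sum poly_point_indicator)
    then have "?E * subst_Var y ?f \<in> J"
      using J by (intro ideal.subspace_scale subst_Var_vanishing field) auto
    moreover have "subst_Var y 1 = (1 :: ('m, 'a) mpoly)"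
      by (simp add: one_pCons)
    ultimately have "(\<Sum>b\<in>UNIV. ?E * subst_Var y (point_indicator b)) - ?E \<in> J"
      by (simp only: subst_Var_minus subst_Var_sum sum_distrib_left right_diff_distrib mult_1_right)
    from ideal.subspace_diff[OF J sum_in this] show ?thesis by simp
  qed
  then show ?case by (rule insert.IH)
qed

text \<open>Induction over the generators. For a variable, \<open>X - p_x\<close> times the
  indicator of \<open>p_x\<close> vanishes on the whole field, so its substitution lies in
  \<open>J\<close>; sums and products follow from the ideal laws.\<close>

lemma eval_mod_ideal:
  fixes J :: "('m::finite, 'a::{field,finite}) mpoly set"
  assumes J: "ideal.subspace J" and field: "\<And>x. Var x ^ CARD('a) - Var x \<in> J"
  defines "E p \<equiv> \<Prod>x\<in>UNIV. subst_Var x (point_indicator (p $ x))"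
  shows "G * E p - Const (poly_eval G p) * E p \<in> J"
proof (induction G rule: mpoly_induct)
  case (Const c)
  then show ?case using ideal.subspace_0[OF J] by (simp add: poly_eval_Const)
next
  case (Var x)
  let ?f = "[:- (p $ x), 1:] * point_indicator (p $ x)"
  let ?R = "\<Prod>y\<in>UNIV - {x}. subst_Var y (point_indicator (p $ y))"
  have "E p = subst_Var x (point_indicator (p $ x)) * ?R"
    unfolding E_def by (simp add: prod.remove)
  then have "Var x * E p - Const (poly_eval (Var x) p) * E p = ?R * subst_Var x ?f"
    by (simp only: subst_Var_mult poly_eval_Var subst_Var_X_minus left_diff_distrib
        right_diff_distrib mult_ac)
  moreover have "subst_Var x ?f \<in> J"
    by (rule subst_Var_vanishing[OF J field]) (simp add: poly_point_indicator)
  ultimately show ?case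
    using ideal.subspace_scale[OF J] by simp
next
  case (add F G)
  from ideal.subspace_add[OF J add] show ?case
    by (simp only: poly_eval_add Const_add distrib_right add_diff_add)
next
  case (mult F G)
  \<comment> \<open>The mixed term \<open>G(p) F E_p\<close> is inserted, so that each induction
    hypothesis applies to one summand.\<close>
  have "F * G * E p - Const (poly_eval (F * G) p) * E p
      = F * (G * E p - Const (poly_eval G p) * E p)
        + Const (poly_eval G p) * (F * E p - Const (poly_eval F p) * E p)"
    by (simp only: poly_eval_mult Const_mult right_diff_distrib mult_ac add_diff_eq diff_add_cancel)
  then show ?case
    using mult J by (simp add: ideal.subspace_add ideal.subspace_scale)
qed

text \<open>At a point of the variety, \<open>G E_p\<close> is congruent to
  \<open>G(p) E_p = 0\<close>. At any other point some \<open>H\<close> in \<open>J\<close> has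
  \<open>H(p)\<close> nonzero; then \<open>H(p) E_p\<close> lies in \<open>J\<close>, hence so does
  \<open>G E_p\<close>.\<close>

lemma finite_field_nullstellensatz:
  fixes J :: "('m::finite, 'a::{field,finite}) mpoly set"
  assumes J: "ideal.subspace J" and field: "\<And>x. Var x ^ CARD('a) - Var x \<in> J"
    and G: "\<And>p. p \<in> variety J \<Longrightarrow> poly_eval G p = 0"
  shows "G \<in> J"
proof (rule ideal_localize[OF J field finite_class.finite_UNIV])
  fix a :: "'m \<Rightarrow> 'a"
  define p :: "'a ^ 'm" where "p = (\<chi> x. a x)"
  define E where "E = (\<Prod>x\<in>UNIV. subst_Var x (point_indicator (p $ x)))"
  have eval: "H * E - Const (poly_eval H p) * E \<in> J" for H
    unfolding E_def by (rule eval_mod_ideal[OF J field])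
  have "G * E \<in> J"
  proof (cases "p \<in> variety J")
    case True
    then show ?thesis using eval[of G] G by simp
  next
    case False
    then obtain H where H: "H \<in> J" and nz: "poly_eval H p \<noteq> 0"
      by (auto simp: variety_def)
    have "E * H \<in> J" using H by (rule ideal.subspace_scale[OF J])
    then have "E * H - (H * E - Const (poly_eval H p) * E) \<in> J"
      using eval by (rule ideal.subspace_diff[OF J])
    then have "Const (poly_eval H p) * E \<in> J"
      by (simp only: mult.commute[of E] diff_diff_eq2 add_diff_cancel_left')
    then have "G * Const (inverse (poly_eval H p)) * (Const (poly_eval H p) * E) \<in> J"
      by (rule ideal.subspace_scale[OF J])
    moreover have "G * Const (inverse (poly_eval H p)) * (Const (poly_eval H p) * E) = G * E"
      using nz by (simp add: mult.assoc flip: mult.assoc[of "Const _" "Const _"] Const_mult)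
    ultimately show ?thesis by simp
  qed
  then show "G * (\<Prod>x\<in>UNIV. subst_Var x (point_indicator (a x))) \<in> J"
    by (simp add: E_def p_def)
qed

section \<open>The ideal \<open>Iq I\<close>\<close>

lemma ideal_sum_subspace:
  assumes "ideal.subspace J" "ideal.subspace K"
  shows "ideal.subspace (ideal_sum J K)"
proof (rule ideal.subspaceI)
  show "0 \<in> ideal_sum J K"
    unfolding ideal_sum_def using assms[THEN ideal.subspace_0] by force
next
  fix F G assume "F \<in> ideal_sum J K" "G \<in> ideal_sum J K"
  then obtain f1 g1 f2 g2 where
    "F = f1 + g1" "G = f2 + g2" "f1 \<in> J" "g1 \<in> K" "f2 \<in> J" "g2 \<in> K"
    unfolding ideal_sum_def by blast
  then have "F + G = (f1 + f2) + (g1 + g2)" "f1 + f2 \<in> J" "g1 + g2 \<in> K"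
    using assms[THEN ideal.subspace_add] by (simp_all only: ac_simps)
  then show "F + G \<in> ideal_sum J K"
    unfolding ideal_sum_def by blast
next
  fix c F assume "F \<in> ideal_sum J K"
  then obtain f g where "F = f + g" "f \<in> J" "g \<in> K"
    unfolding ideal_sum_def by blast
  then have "c * F = c * f + c * g" "c * f \<in> J" "c * g \<in> K"
    using assms[THEN ideal.subspace_scale] by (simp_all only: distrib_left)
  then show "c * F \<in> ideal_sum J K"
    unfolding ideal_sum_def by blast
qed

lemma subspace_Iq:
  assumes "ideal.subspace I"
  shows "ideal.subspace (Iq I)"
  unfolding Iq_def by (rule ideal_sum_subspace[OF assms ideal.subspace_span])

lemma field_equation_in_Iq:
  fixes I :: "('m, 'a::{field,finite}) mpoly set"
  assumes "ideal.subspace I"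
  shows "Var x ^ CARD('a) - Var x \<in> Iq I"
proof -
  have "Var x ^ CARD('a) - Var x
      \<in> ideal.span {Var x ^ CARD('a) - Var x :: ('m, 'a) mpoly | x. True}"
    by (rule ideal.span_base) blast
  then show ?thesis
    unfolding Iq_def ideal_sum_def using ideal.subspace_0[OF assms] by force
qed

section \<open>Leading monomials and footprints\<close>

lemma monomial_ordering_greatest:
  assumes "monomial_ordering prec" "finite T" "T \<noteq> {}"
  obtains t where "t \<in> T" "\<And>s. s \<in> T \<Longrightarrow> s \<noteq> t \<Longrightarrow> prec s t"
proof -
  have "transp_on T prec" "totalp_on T prec"
    using assms(1) unfolding monomial_ordering_def
    by (auto intro: transp_on_subset totalp_on_subset)
  then show thesis
    using Finite_Set.bex_greatest_element[of T prec] assms(2,3) that by blast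
qed

lemma monomial_ordering_asym:
  assumes "monomial_ordering prec" "prec s t"
  shows "\<not> prec t s"
  using assms unfolding monomial_ordering_def by (meson irreflpD transpD)

lemma lm_eqI:
  assumes "monomial_ordering prec" "t \<in> Poly_Mapping.keys F"
    and "\<And>s. s \<in> Poly_Mapping.keys F \<Longrightarrow> s \<noteq> t \<Longrightarrow> prec s t"
  shows "lm prec F = t"
  unfolding lm_def
proof (rule the_equality)
  show "t' = t" if "t' \<in> Poly_Mapping.keys F \<and> (\<forall>s\<in>Poly_Mapping.keys F. s \<noteq> t' \<longrightarrow> prec s t')" for t'
    using that assms monomial_ordering_asym by metis
qed (use assms in blast)

text \<open>A nonzero polynomial has finitely many keys and at least one, so a greatest key exists;
  it is the value of the \<open>THE\<close> in \<open>lm\<close>.\<close>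

lemma
  assumes "monomial_ordering prec" "F \<noteq> 0"
  shows lm_in_keys: "lm prec F \<in> Poly_Mapping.keys F"
    and prec_lm: "s \<in> Poly_Mapping.keys F \<Longrightarrow> s \<noteq> lm prec F \<Longrightarrow> prec s (lm prec F)"
proof -
  have "Poly_Mapping.keys F \<noteq> {}"
    using assms(2) by simp
  then obtain t where t: "t \<in> Poly_Mapping.keys F"
      "\<And>s. s \<in> Poly_Mapping.keys F \<Longrightarrow> s \<noteq> t \<Longrightarrow> prec s t"
    using monomial_ordering_greatest[OF assms(1) finite_keys] by blast
  then have "lm prec F = t"
    by (rule lm_eqI[OF assms(1)])
  with t show "lm prec F \<in> Poly_Mapping.keys F"
    and "s \<in> Poly_Mapping.keys F \<Longrightarrow> s \<noteq> lm prec F \<Longrightarrow> prec s (lm prec F)"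
    by blast+
qed

text \<open>Otherwise the leading monomial would lie both in the footprint and in its
  complement.\<close>

lemma footprint_supported_eq_0:
  assumes "monomial_ordering prec" "F \<in> J" "Poly_Mapping.keys F \<subseteq> footprint prec J"
  shows "F = 0"
proof (rule ccontr)
  assume "F \<noteq> 0"
  then have "lm prec F \<in> lead_monoms prec J" "lm prec F \<in> Poly_Mapping.keys F"
    using assms lm_in_keys by (auto simp: lead_monoms_def)
  then show False
    using assms(3) by (auto simp: footprint_def)
qed

text \<open>The leading monomials are pairwise distinct, so the greatest \<open>t\<close> with
  nonzero coefficient cannot be cancelled by the other summands.\<close>

lemma lm_combination:
  fixes G :: "'m monom \<Rightarrow> ('m, 'a::field) mpoly"
  assumes prec: "monomial_ordering prec" and "finite T"
    and G: "\<And>t. t \<in> T \<Longrightarrow> G t \<noteq> 0 \<and> lm prec (G t) = t"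
    and d: "t1 \<in> T" "d t1 \<noteq> 0"
  shows "(\<Sum>t\<in>T. Const (d t) * G t) \<noteq> 0 \<and> lm prec (\<Sum>t\<in>T. Const (d t) * G t) \<in> T"
proof -
  define R where "R = (\<Sum>t\<in>T. Const (d t) * G t)"
  have R: "Poly_Mapping.lookup R s = (\<Sum>t\<in>T. d t * Poly_Mapping.lookup (G t) s)" for s
    by (simp only: R_def lookup_sum lookup_Const_mult)
  have supp: "finite {t \<in> T. d t \<noteq> 0}" "{t \<in> T. d t \<noteq> 0} \<noteq> {}"
    using assms(2) d by auto
  obtain t0 where t0: "t0 \<in> T" "d t0 \<noteq> 0"
    and max: "\<And>t. t \<in> T \<Longrightarrow> d t \<noteq> 0 \<Longrightarrow> t \<noteq> t0 \<Longrightarrow> prec t t0"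
    by (rule monomial_ordering_greatest[OF prec supp]) blast
  \<comment> \<open>Every monomial of \<open>G t\<close> is at most \<open>t\<close>, so for smaller
    \<open>t\<close> it cannot reach \<open>t0\<close>.\<close>
  have G_below: "s = t \<or> prec s t" if "t \<in> T" "Poly_Mapping.lookup (G t) s \<noteq> 0" for s t
    using prec_lm[OF prec, of "G t" s] G[OF that(1)] that(2) by (auto simp: in_keys_iff)
  have "d t * Poly_Mapping.lookup (G t) t0 = 0" if "t \<in> T - {t0}" for t
    using G_below[of t t0] max[of t] that monomial_ordering_asym[OF prec] by auto
  then have "(\<Sum>t\<in>T - {t0}. d t * Poly_Mapping.lookup (G t) t0) = 0"
    by (rule sum.neutral[OF ballI])
  then have "Poly_Mapping.lookup R t0 = d t0 * Poly_Mapping.lookup (G t0) t0"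
    using assms(2) t0(1) by (simp add: R sum.remove[of T t0])
  moreover have "Poly_Mapping.lookup (G t0) t0 \<noteq> 0"
    using lm_in_keys[OF prec, of "G t0"] G[OF t0(1)] by (auto simp: in_keys_iff)
  ultimately have t0_key: "t0 \<in> Poly_Mapping.keys R"
    using t0(2) by (simp add: in_keys_iff)
  have "lm prec R = t0"
  proof (rule lm_eqI[OF prec t0_key])
    fix s assume "s \<in> Poly_Mapping.keys R" and ne: "s \<noteq> t0"
    then obtain t where "t \<in> T" "d t * Poly_Mapping.lookup (G t) s \<noteq> 0"
      unfolding in_keys_iff R by (meson sum.not_neutral_contains_not_neutral)
    then have t: "t \<in> T" "d t \<noteq> 0" "Poly_Mapping.lookup (G t) s \<noteq> 0"
      by auto
    have "s = t \<or> prec s t" "t = t0 \<or> prec t t0"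
      using G_below t max by blast+
    then show "prec s t0"
      using ne prec unfolding monomial_ordering_def by (metis transpD)
  qed
  then show ?thesis
    using t0(1) t0_key unfolding R_def by (metis keys_zero empty_iff)
qed

section \<open>The footprint bound on the Hamming weight\<close>

lemma variety_ideal_sum_span:
  assumes "G \<in> ideal_sum (ideal.span {F}) J" "p \<in> variety J" "poly_eval F p = 0"
  shows "poly_eval G p = 0"
  using assms unfolding ideal_sum_def ideal.span_singleton variety_def
  by (auto simp: poly_eval_add poly_eval_mult)

text \<open>Linear independence enters in counting form: an injection from the coefficient vectors
  on \<open>T\<close> to the value vectors on \<open>S\<close> gives
  \<open>q ^ card T \<le> q ^ card S\<close>.\<close>

lemma card_lead_monoms_le_weight:
  fixes J :: "('m::finite, 'a::{field,finite}) mpoly set" and P :: "'n::finite \<Rightarrow> 'a ^ 'm"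
  assumes J: "ideal.subspace J" and field: "\<And>x. Var x ^ CARD('a) - Var x \<in> J"
    and prec: "monomial_ordering prec" and P: "range P = variety J"
    and fin: "finite (footprint prec J)"
  shows "card (footprint prec J \<inter> lead_monoms prec (ideal_sum (ideal.span {F}) J))
           \<le> hamming_weight (ev P F)"
proof -
  define T where "T = footprint prec J \<inter> lead_monoms prec (ideal_sum (ideal.span {F}) J)"
  define S where "S = {j. poly_eval F (P j) \<noteq> 0}"
  have "finite T" using fin by (simp add: T_def)
  have "\<forall>t\<in>T. \<exists>G. G \<in> ideal_sum (ideal.span {F}) J \<and> G \<noteq> 0 \<and> lm prec G = t"
    unfolding T_def lead_monoms_def by blast
  then obtain G where G_in: "\<And>t. t \<in> T \<Longrightarrow> G t \<in> ideal_sum (ideal.span {F}) J"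
    and G_lm: "\<And>t. t \<in> T \<Longrightarrow> G t \<noteq> 0 \<and> lm prec (G t) = t"
    by metis
  have G_zero: "poly_eval (G t) (P j) = 0" if "t \<in> T" "j \<notin> S" for t j
    using variety_ideal_sum_span[OF G_in[OF that(1)]] that(2) P by (auto simp: S_def)
  \<comment> \<open>Nothing is lost by restricting to \<open>S\<close>, since every
    \<open>G t\<close> vanishes at the other points; the values then lie in a space of size
    \<open>q ^ card S\<close>.\<close>
  define \<Phi> where "\<Phi> d = (\<lambda>j\<in>S. \<Sum>t\<in>T. d t * poly_eval (G t) (P j))" for d
  have "inj_on \<Phi> (T \<rightarrow>\<^sub>E UNIV)"
  proof (rule inj_onI, rule ccontr)
    fix d e assume d: "d \<in> T \<rightarrow>\<^sub>E (UNIV :: 'a set)" and e: "e \<in> T \<rightarrow>\<^sub>E (UNIV :: 'a set)"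
      and eq: "\<Phi> d = \<Phi> e" and "d \<noteq> e"
    then obtain t1 where t1: "t1 \<in> T" "d t1 - e t1 \<noteq> 0"
      by (metis PiE_ext right_minus_eq)
    let ?R = "\<Sum>t\<in>T. Const (d t - e t) * G t"
    have "poly_eval ?R (P j) = 0" for j
    proof -
      have "poly_eval ?R (P j)
          = (\<Sum>t\<in>T. d t * poly_eval (G t) (P j)) - (\<Sum>t\<in>T. e t * poly_eval (G t) (P j))"
        by (simp only: poly_eval_sum poly_eval_mult poly_eval_Const left_diff_distrib sum_subtractf)
      also have "\<dots> = 0"
        using fun_cong[OF eq, of j] G_zero by (cases "j \<in> S") (simp_all add: \<Phi>_def)
      finally show ?thesis .
    qed
    \<comment> \<open>A collision of \<open>\<Phi>\<close> yields a nontrivial combination vanishing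
      on the variety. It lies in \<open>J\<close>, while its leading monomial is in the
      footprint.\<close>
    then have "?R \<in> J"
      using P by (intro finite_field_nullstellensatz[OF J field]) (auto simp flip: P)
    moreover have "?R \<noteq> 0 \<and> lm prec ?R \<in> T"
      using t1 by (intro lm_combination[OF prec \<open>finite T\<close> G_lm])
    ultimately have "lm prec ?R \<in> lead_monoms prec J" "lm prec ?R \<in> footprint prec J"
      unfolding T_def lead_monoms_def by blast+
    then show False
      unfolding footprint_def by (metis ComplD)
  qed
  moreover have "\<Phi> ` (T \<rightarrow>\<^sub>E UNIV) \<subseteq> S \<rightarrow>\<^sub>E (UNIV :: 'a set)"
    by (auto simp: \<Phi>_def)
  ultimately have "card (T \<rightarrow>\<^sub>E (UNIV :: 'a set)) \<le> card (S \<rightarrow>\<^sub>E (UNIV :: 'a set))"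
    by (rule card_inj_on_le) (simp add: finite_PiE)
  then have "CARD('a) ^ card T \<le> CARD('a) ^ card S"
    using \<open>finite T\<close> by (simp add: card_PiE)
  moreover have "CARD('a) > 1"
    using card_mono[of UNIV "{0, 1::'a}"] by simp
  ultimately have "card T \<le> card S"
    by simp
  then show ?thesis
    by (simp add: T_def S_def hamming_weight_def ev_def)
qed

text \<open>Injectivity of evaluation on footprint-supported polynomials: a zero evaluation puts
  \<open>F\<close> into \<open>J\<close>, where no nonzero polynomial has such support.\<close>

lemma footprint_ev_eq_0:
  fixes J :: "('m::finite, 'a::{field,finite}) mpoly set" and P :: "'n::finite \<Rightarrow> 'a ^ 'm"
  assumes J: "ideal.subspace J" and field: "\<And>x. Var x ^ CARD('a) - Var x \<in> J"
    and prec: "monomial_ordering prec" and P: "range P = variety J"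
    and F: "Poly_Mapping.keys F \<subseteq> footprint prec J" "ev P F = 0"
  shows "F = 0"
proof (rule footprint_supported_eq_0[OF prec _ F(1)])
  have "poly_eval F (P j) = 0" for j
    using F(2) by (simp add: ev_def vec_eq_iff)
  then show "F \<in> J"
    by (intro finite_field_nullstellensatz[OF J field]) (auto simp flip: P)
qed

section \<open>Codes as images of evaluation\<close>

lemma ev_0 [simp]: "ev P 0 = 0"
  by (simp add: ev_def vec_eq_iff)

lemma ev_add: "ev P (F + G) = ev P F + ev P G"
  by (simp add: ev_def vec_eq_iff poly_eval_add)

lemma ev_minus: "ev P (F - G) = ev P F - ev P G"
  by (simp add: ev_def vec_eq_iff poly_eval_minus)

lemma ev_Const_mult: "ev P (Const c * F) = c *s ev P F"
  by (simp add: ev_def vec_eq_iff poly_eval_mult poly_eval_Const)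

text \<open>Represents each codeword by a polynomial with support in \<open>L\<close>, to which the
  weight bound can be applied.\<close>

lemma code_eq:
  fixes P :: "'n::finite \<Rightarrow> 'a::field ^ 'm::finite"
  shows "code P L = ev P ` {F. Poly_Mapping.keys F \<subseteq> L}"
proof
  have "vec.subspace (ev P ` {F. Poly_Mapping.keys F \<subseteq> L})"
  proof (rule vec.subspaceI)
    show "0 \<in> ev P ` {F. Poly_Mapping.keys F \<subseteq> L}"
      by (rule image_eqI[of _ _ 0]) simp_all
  next
    fix x y assume "x \<in> ev P ` {F. Poly_Mapping.keys F \<subseteq> L}"
      and "y \<in> ev P ` {F. Poly_Mapping.keys F \<subseteq> L}"
    then obtain F G where "x = ev P F" "y = ev P G"
      and "Poly_Mapping.keys F \<subseteq> L" "Poly_Mapping.keys G \<subseteq> L"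
      by blast
    then have "x + y = ev P (F + G)" "Poly_Mapping.keys (F + G) \<subseteq> L"
      using keys_add[of F G] by (simp only: ev_add, blast)
    then show "x + y \<in> ev P ` {F. Poly_Mapping.keys F \<subseteq> L}" by blast
  next
    fix c x assume "x \<in> ev P ` {F. Poly_Mapping.keys F \<subseteq> L}"
    then obtain F where "x = ev P F" and F: "Poly_Mapping.keys F \<subseteq> L"
      by blast
    then have "c *s x = ev P (Const c * F)" by (simp only: ev_Const_mult)
    moreover have "Poly_Mapping.keys (Const c * F) \<subseteq> L"
      using F by (auto simp: in_keys_iff lookup_Const_mult)
    ultimately show "c *s x \<in> ev P ` {F. Poly_Mapping.keys F \<subseteq> L}" by blast
  qed
  moreover have "{ev P (monom_poly t) | t. t \<in> L} \<subseteq> ev P ` {F. Poly_Mapping.keys F \<subseteq> L}"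
    by (auto simp: monom_poly_def intro!: imageI)
  ultimately show "code P L \<subseteq> ev P ` {F. Poly_Mapping.keys F \<subseteq> L}"
    unfolding code_def by (intro vec.span_minimal)
next
  show "ev P ` {F. Poly_Mapping.keys F \<subseteq> L} \<subseteq> code P L"
  proof (rule image_subsetI)
    fix F :: "('m, 'a) mpoly" assume "F \<in> {F. Poly_Mapping.keys F \<subseteq> L}"
    then have "(\<Sum>t\<in>Poly_Mapping.keys F. Poly_Mapping.lookup F t *s ev P (monom_poly t)) \<in> code P L"
      unfolding code_def by (intro vec.span_sum vec.span_scale vec.span_base) auto
    moreover have "ev P F
        = (\<Sum>t\<in>Poly_Mapping.keys F. Poly_Mapping.lookup F t *s ev P (monom_poly t))"
      by (simp add: ev_def vec_eq_iff monom_poly_def poly_eval_single poly_eval_eq_sum[OF finite_keys])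
    ultimately show "ev P F \<in> code P L" by simp
  qed
qed

lemma hamming_dist_eq_weight: "hamming_dist c d = hamming_weight (c - d :: 'a::ab_group_add ^ 'n::finite)"
  by (simp add: hamming_dist_def hamming_weight_def)

section \<open>The bounds on minimum and relative distance\<close>

theorem theorem4:
  fixes I :: "('m::finite, 'a::{field,finite}) mpoly set"
    and prec :: "'m monom \<Rightarrow> 'm monom \<Rightarrow> bool"
    and P :: "'n::finite \<Rightarrow> 'a ^ 'm"
    and n :: nat
    and M :: "nat \<Rightarrow> 'm monom"
    and \<sigma> :: "'m monom \<Rightarrow> int"
  assumes I: "ideal.subspace I"
    and prec: "monomial_ordering prec"
    and P: "bij_betw P UNIV (variety (Iq I))"
    and M: "footprint prec (Iq I) = M ` {1..n}"
    and M_increasing: "\<And>i j. \<lbrakk>i \<in> {1..n}; j \<in> {1..n}; i < j\<rbrakk> \<Longrightarrow> prec (M i) (M j)"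
    and \<sigma>: "\<And>i F. \<lbrakk>i \<in> {1..n}; F \<noteq> 0; Poly_Mapping.keys F \<subseteq> footprint prec (Iq I); lm prec F = M i\<rbrakk>
           \<Longrightarrow> \<sigma> (M i) \<le> int (card (footprint prec (Iq I) \<inter>
                                  lead_monoms prec (ideal_sum (ideal.span {F}) (Iq I))))"
  shows "(\<forall>L. L \<subseteq> footprint prec (Iq I) \<and> L \<noteq> {} \<longrightarrow>
            Min {\<sigma> t | t. t \<in> L} \<le> int (min_distance (code P L)))
       \<and> (\<forall>L1 L2. L2 \<subset> L1 \<and> L1 \<subseteq> footprint prec (Iq I) \<longrightarrow>
            (let n12 = Min {i \<in> {1..n}. M i \<in> L1 - L2}
             in Min {\<sigma> (M i) | i. i \<in> {1..n} \<and> M i \<in> L1 \<and> n12 \<le> i}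
                  \<le> int (relative_distance (code P L1) (code P L2))))"
proof -
  let ?J = "Iq I"
  note J = subspace_Iq[OF I] and field = field_equation_in_Iq[OF I]
  have rangeP: "range P = variety ?J"
    using P by (rule bij_betw_imp_surj_on)
  have fin: "finite (footprint prec ?J)"
    by (simp add: M)
  \<comment> \<open>The common core of both parts: the leading monomial of \<open>F\<close> is some
    \<open>M i\<close>, so the assumption on \<open>\<sigma>\<close> combines with the footprint
    bound.\<close>
  have weight: "\<sigma> (lm prec F) \<le> int (hamming_weight (ev P F))"
    if "F \<noteq> 0" "Poly_Mapping.keys F \<subseteq> footprint prec ?J" for F
  proof -
    have "lm prec F \<in> M ` {1..n}"
      using lm_in_keys[OF prec that(1)] that(2) M by blast
    then obtain i where i: "i \<in> {1..n}" "lm prec F = M i" by blast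
    show ?thesis
      using \<sigma>[OF i(1) that i(2)] i(2)
        card_lead_monoms_le_weight[OF J field prec rangeP fin, of F] by simp
  qed
  have part1: "Min {\<sigma> t | t. t \<in> L} \<le> int (min_distance (code P L))"
    if L: "L \<subseteq> footprint prec ?J" and "L \<noteq> {}" for L
  proof -
    let ?D = "{hamming_dist c d | c d. c \<in> code P L \<and> d \<in> code P L \<and> c \<noteq> d}"
    \<comment> \<open>The codeword of \<open>t\<close> is nonzero and thus differs from
      \<open>0\<close>, so the minimum runs over a nonempty finite set and is attained.\<close>
    obtain t where "t \<in> L" using \<open>L \<noteq> {}\<close> by blast
    then have "Poly_Mapping.keys (monom_poly t :: ('m, 'a) mpoly) \<subseteq> L"
      by (simp add: monom_poly_def)
    moreover have "monom_poly t \<noteq> (0 :: ('m, 'a) mpoly)"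
      by (metis monom_poly_def lookup_single_eq lookup_zero zero_neq_one)
    ultimately have "ev P (monom_poly t) \<in> code P L" "ev P (monom_poly t) \<noteq> 0"
      using footprint_ev_eq_0[OF J field prec rangeP] L unfolding code_eq by blast+
    moreover have "0 \<in> code P L"
      by (simp add: code_def vec.span_zero)
    ultimately have "?D \<noteq> {}" by blast
    moreover have "finite ?D"
      by (rule finite_subset[of _ "range (\<lambda>(c, d). hamming_dist c d)"]) auto
    ultimately have "min_distance (code P L) \<in> ?D"
      unfolding min_distance_def by (rule Min_in[rotated])
    then obtain c d where cd: "c \<in> code P L" "d \<in> code P L" "c \<noteq> d"
      and dist: "min_distance (code P L) = hamming_weight (c - d)"
      unfolding hamming_dist_eq_weight by blast
    have "c - d \<in> code P L"
      using cd(1,2) unfolding code_def by (rule vec.span_diff)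
    then obtain F where F: "c - d = ev P F" "Poly_Mapping.keys F \<subseteq> L"
      unfolding code_eq by blast
    then have "F \<noteq> 0" using cd(3) by auto
    then have "Min {\<sigma> t | t. t \<in> L} \<le> \<sigma> (lm prec F)"
      using lm_in_keys[OF prec] F(2) finite_subset[OF L fin] by (intro Min_le) auto
    also have "\<dots> \<le> int (min_distance (code P L))"
      using weight[OF \<open>F \<noteq> 0\<close>] F L dist by simp
    finally show ?thesis .
  qed
  have part2: "Min {\<sigma> (M i) | i. i \<in> {1..n} \<and> M i \<in> L1 \<and> Min {i \<in> {1..n}. M i \<in> L1 - L2} \<le> i}
      \<le> int (relative_distance (code P L1) (code P L2))"
    if "L2 \<subset> L1" and L1: "L1 \<subseteq> footprint prec ?J" for L1 L2
  proof -
    let ?m = "Min {i \<in> {1..n}. M i \<in> L1 - L2}"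
    let ?D = "{hamming_weight c | c. c \<in> code P L1 - code P L2}"
    obtain t where t: "t \<in> L1" "t \<notin> L2" using \<open>L2 \<subset> L1\<close> by blast
    have keys_t: "Poly_Mapping.keys (monom_poly t :: ('m, 'a) mpoly) = {t}"
      by (simp add: monom_poly_def)
    \<comment> \<open>By injectivity of evaluation on the footprint, \<open>t\<close> would have to
      occur in a polynomial supported on \<open>L2\<close>. Hence the set of weights is nonempty and
      its minimum is attained.\<close>
    have "ev P (monom_poly t) \<notin> code P L2"
    proof
      assume "ev P (monom_poly t) \<in> code P L2"
      then obtain F where F: "ev P (monom_poly t) = ev P F" "Poly_Mapping.keys F \<subseteq> L2"
        unfolding code_eq by blast
      let ?G = "monom_poly t - F"
      have "Poly_Mapping.keys ?G \<subseteq> {t} \<union> Poly_Mapping.keys F"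
        using keys_diff[of "monom_poly t" F] unfolding keys_t .
      then have "Poly_Mapping.keys ?G \<subseteq> footprint prec ?J"
        using t F(2) \<open>L2 \<subset> L1\<close> L1 by blast
      then have "?G = 0"
        by (rule footprint_ev_eq_0[OF J field prec rangeP]) (simp add: ev_minus F(1))
      then have "Poly_Mapping.keys F = {t}" using keys_t by (simp only: right_minus_eq)
      then show False using F(2) t(2) by blast
    qed
    moreover have "ev P (monom_poly t) \<in> code P L1"
      using t(1) unfolding code_eq by (intro imageI CollectI) (simp add: keys_t)
    ultimately have "?D \<noteq> {}" by blast
    moreover have "finite ?D"
      by (rule finite_subset[of _ "range hamming_weight"]) auto
    ultimately have "relative_distance (code P L1) (code P L2) \<in> ?D"
      unfolding relative_distance_def by (rule Min_in[rotated])
    then obtain c where c: "c \<in> code P L1" "c \<notin> code P L2"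
      and dist: "relative_distance (code P L1) (code P L2) = hamming_weight c"
      by blast
    obtain F where F: "c = ev P F" "Poly_Mapping.keys F \<subseteq> L1"
      using c(1) unfolding code_eq by blast
    then have "\<not> Poly_Mapping.keys F \<subseteq> L2"
      using c(2) unfolding code_eq by blast
    then obtain s where s: "s \<in> Poly_Mapping.keys F" "s \<notin> L2" by blast
    then have "F \<noteq> 0" by auto
    have "s \<in> M ` {1..n}" "lm prec F \<in> M ` {1..n}"
      using s(1) lm_in_keys[OF prec \<open>F \<noteq> 0\<close>] F(2) L1 M by blast+
    then obtain i j where i: "i \<in> {1..n}" "lm prec F = M i" and j: "j \<in> {1..n}" "s = M j"
      by blast
    \<comment> \<open>The index \<open>j\<close> of a monomial in \<open>L1 - L2\<close> links the
      two bounds: \<open>?m\<close> is the least such index, and \<open>M j\<close> is at most the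
      leading monomial \<open>M i\<close>.\<close>
    have "?m \<le> j"
      using j s F(2) by (intro Min_le) auto
    also have "j \<le> i"
    proof (rule ccontr)
      assume "\<not> j \<le> i"
      then have above: "prec (lm prec F) s"
        using M_increasing i j by simp
      have "s \<noteq> lm prec F"
        using above monomial_ordering_asym[OF prec above] by metis
      from prec_lm[OF prec \<open>F \<noteq> 0\<close> s(1) this] monomial_ordering_asym[OF prec above]
      show False by contradiction
    qed
    finally have "?m \<le> i" .
    moreover have "M i \<in> L1"
      using lm_in_keys[OF prec \<open>F \<noteq> 0\<close>] F(2) i(2) by auto
    ultimately have "Min {\<sigma> (M i) | i. i \<in> {1..n} \<and> M i \<in> L1 \<and> ?m \<le> i} \<le> \<sigma> (M i)"
      using i(1) by (intro Min_le) auto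
    also have "\<dots> \<le> int (relative_distance (code P L1) (code P L2))"
      using weight[OF \<open>F \<noteq> 0\<close>] F L1 dist i(2) by simp
    finally show ?thesis .
  qed
  from part1 part2 show ?thesis
    unfolding Let_def by blast
qed

end
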